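(* Let $(X,\tau)$ be a hereditarily Lindelöf topological space ($\tau$ its family of open sets) and let $\mathfrak B\subseteq\mathcal P(X)$ be a family closed under (finite) intersections and well-founded under $\subseteq$. Let $\mathfrak B\sqcap\tau=\{B\cap G: B\in\mathfrak B,\ G\in\tau\}$ and let $\sqcup(\mathfrak B\sqcap\tau)=\{\bigcup\mathcal X:\mathcal X\subseteq\mathfrak B\sqcap\tau,\ |\mathcal X|=\omega\}$. Then every cover $\mathbf H$ (possibly with multiplicity) with $\mathcal H\subseteq\sqcup(\mathfrak B\sqcap\tau)$ has an $[\omega_1,\infty)$-good coloring.
   Context: Well-founded under $\subseteq$: every nonempty subfamily has a $\subseteq$-minimal element. Covers with multiplicity: for $\mathcal H\subseteq\mathcal P(X)$ and $m:\mathcal H\to\mathrm{On}\setminus\{0\}$, $\mathbf H=\{\langle H,\alpha\rangle: H\in\mathcal H,\alpha<m(H)\}$ and $\mathbf H(x)=\{\langle H,\alpha\rangle\in\mathbf H: x\in H\}$; "cover" means cover of $\bigcup\mathcal H$. A partial function $c:\mathbf H\to\mathrm{On}$ is an $[\omega_1,\infty)$-good coloring if for every cardinal $\lambda\ge\omega_1$ and every $x\in\bigcup\mathcal H$ with $|\mathbf H(x)|\ge\lambda$ we have $\lambda\subseteq c[\mathbf H(x)]$ ($c[A]$ being the set of values of $c$ on $A\cap\mathrm{dom}(c)$). *)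

theory Defs
  imports "HOL-Analysis.Analysis"
begin

text \<open>
  \<open>=o\<close> is the order isomorphism of the cardinals library, not the \<open>=o\<close> of
  HOL-Library.Set_Algebras.
\<close>

no_notation elt_set_eq (infix "=o" 50)
unbundle cardinal_syntax

section \<open>Ordinals\<close>

text \<open>
  HOL has no type of all ordinals. \<open>'i ordinal\<close> consists of the order types of the well-orders on
  subsets of the type \<open>'i\<close>, so for infinite \<open>'i\<close> it is the set of all ordinals below the
  successor cardinal of \<open>'i\<close>. It is an initial segment of the class of ordinals: the elements
  below \<open>\<alpha>\<close> are all ordinals below \<open>\<alpha>\<close>, and the von Neumann ordinal \<open>\<alpha>\<close> is rendered as
  \<open>{..<\<alpha>}\<close>. Every function from a set to the ordinals has its values in \<open>'i ordinal\<close> for a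
  suitable \<open>'i\<close>.
\<close>

quotient_type 'i ordinal = "'i rel" / partial: "\<lambda>r s. r =o s"
proof (rule part_equivpI)
  show "\<exists>r :: 'i rel. r =o r"
    by (rule exI[of _ "{}"]) (simp add: ordIso_reflexive)
  show "symp (\<lambda>r s :: 'i rel. r =o s)"
    by (auto intro: sympI ordIso_symmetric)
  show "transp (\<lambda>r s :: 'i rel. r =o s)"
    by (auto intro: transpI ordIso_transitive)
qed

lemma ordIso_self_iff: "r =o r \<longleftrightarrow> Well_order r"
  by (auto simp: ordIso_reflexive) (simp add: ordIso_def)

lemma abs_ordinal_cases:
  obtains r where "r =o r" "x = abs_ordinal r"
  using Quotient_rep_reflp[OF Quotient_ordinal, of x] Quotient_abs_rep[OF Quotient_ordinal, of x]
  by metis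

instantiation ordinal :: (type) wellorder
begin

lift_definition less_eq_ordinal :: "'i ordinal \<Rightarrow> 'i ordinal \<Rightarrow> bool" is "\<lambda>r s. r \<le>o s"
  by (meson ordIso_ordLeq_trans ordIso_symmetric ordLeq_ordIso_trans)

lift_definition less_ordinal :: "'i ordinal \<Rightarrow> 'i ordinal \<Rightarrow> bool" is "\<lambda>r s. r <o s"
  by (meson ordIso_ordLess_trans ordIso_symmetric ordLess_ordIso_trans)

instance
proof
  fix x y z :: "'i ordinal"
  show "x < y \<longleftrightarrow> x \<le> y \<and> \<not> y \<le> x"
    by transfer (use ordIso_self_iff not_ordLeq_iff_ordLess ordLess_imp_ordLeq in blast)
  show "x \<le> x"
    by transfer (simp add: ordIso_imp_ordLeq)
  show "x \<le> z" if "x \<le> y" "y \<le> z"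
    using that by transfer (rule ordLeq_transitive)
  show "x = y" if "x \<le> y" "y \<le> x"
    using that by transfer (simp add: ordIso_iff_ordLeq)
  show "x \<le> y \<or> y \<le> x"
    by transfer (use ordIso_self_iff ordLess_or_ordLeq ordLess_imp_ordLeq in blast)
next
  fix P :: "'i ordinal \<Rightarrow> bool" and a :: "'i ordinal"
  assume step: "\<And>x. (\<And>y. y < x \<Longrightarrow> P y) \<Longrightarrow> P x"
  have "\<forall>x. x = abs_ordinal r \<longrightarrow> r =o r \<longrightarrow> P x" for r
  proof (induction r rule: wf_induct_rule[OF wf_ordLess])
    case (1 r)
    show ?case
    proof (intro allI impI)
      fix x assume x: "x = abs_ordinal r" and r: "r =o r"
      show "P x"
      proof (rule step)
        fix y assume "y < x"
        obtain s where s: "s =o s" "y = abs_ordinal s"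
          by (rule abs_ordinal_cases)
        with \<open>y < x\<close> x r have "s <o r"
          by (simp add: less_ordinal.abs_eq)
        with 1 s show "P y" by blast
      qed
    qed
  qed
  moreover obtain r where "r =o r" "a = abs_ordinal r"
    by (rule abs_ordinal_cases)
  ultimately show "P a" by blast
qed

end

instantiation ordinal :: (type) zero
begin

lift_definition zero_ordinal :: "'i ordinal" is "{}"
  by (simp add: ordIso_self_iff)

instance ..

end

text \<open>Cardinals are initial ordinals.\<close>

definition cardinal_ordinal :: "'i ordinal \<Rightarrow> bool" where
  "cardinal_ordinal \<kappa> \<longleftrightarrow> (\<forall>\<alpha><\<kappa>. \<not> |{..<\<alpha>}| =o |{..<\<kappa>}| )"


section \<open>Covers with multiplicity and good colorings\<close>

definition with_mult :: "'x set set \<Rightarrow> ('x set \<Rightarrow> 'i ordinal) \<Rightarrow> ('x set \<times> 'i ordinal) set" where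
  "with_mult \<H> m = {(H, \<alpha>). H \<in> \<H> \<and> \<alpha> < m H}"

definition at_point :: "('x set \<times> 'i ordinal) set \<Rightarrow> 'x \<Rightarrow> ('x set \<times> 'i ordinal) set" where
  "at_point HH x = {(H, \<alpha>) \<in> HH. x \<in> H}"

text \<open>
  The partial function \<open>c\<close> has its domain inside the multiset cover \<open>with_mult \<H> m\<close>. Its values
  are ordinals over the type of the members of that cover: every cardinal \<open>\<kappa>\<close> that is at most the
  cardinality of \<open>at_point (with_mult \<H> m) x\<close> is an element of this type, so the
  quantifier over \<open>\<kappa>\<close> omits no cardinal to which the condition applies. For a cardinal \<open>\<kappa>\<close>, the
  condition \<open>\<kappa> \<ge> \<omega>\<^sub>1\<close> is a comparison of cardinalities, with \<open>cardSuc natLeq\<close> as \<open>\<omega>\<^sub>1\<close>.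
\<close>

definition good_coloring_omega1 ::
  "'x set set \<Rightarrow> ('x set \<Rightarrow> 'i ordinal) \<Rightarrow>
    ('x set \<times> 'i ordinal \<rightharpoonup> ('x set \<times> 'i ordinal) ordinal) \<Rightarrow> bool" where
  "good_coloring_omega1 \<H> m c \<longleftrightarrow>
     dom c \<subseteq> with_mult \<H> m \<and>
     (\<forall>\<kappa>. cardinal_ordinal \<kappa> \<and> cardSuc natLeq \<le>o |{..<\<kappa>}| \<longrightarrow>
       (\<forall>x \<in> \<Union>\<H>. |{..<\<kappa>}| \<le>o |at_point (with_mult \<H> m) x| \<longrightarrow>
         {..<\<kappa>} \<subseteq> {\<beta>. \<exists>p \<in> at_point (with_mult \<H> m) x. c p = Some \<beta>}))"


section \<open>Families of sets\<close>

definition well_founded_family :: "'x set set \<Rightarrow> bool" where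
  "well_founded_family \<B> \<longleftrightarrow> (\<forall>\<A>\<subseteq>\<B>. \<A> \<noteq> {} \<longrightarrow> (\<exists>M\<in>\<A>. \<forall>A\<in>\<A>. \<not> A \<subset> M))"

definition family_meet :: "'x set set \<Rightarrow> 'x topology \<Rightarrow> 'x set set" where
  "family_meet \<B> T = {B \<inter> G |B G. B \<in> \<B> \<and> openin T G}"

definition countable_unions :: "'x set set \<Rightarrow> 'x set set" where
  "countable_unions \<S> = {\<Union>\<X> |\<X>. \<X> \<subseteq> \<S> \<and> |\<X>| =o natLeq}"

end

theory Submission
  imports Defs
begin

text \<open>
  Suppose that stages of the family are closed under taking, on each piece cut out by the smallest
  relevant member of \<open>\<B>\<close>, sufficiently many disjoint countable Lindelof subcovers. Then a point lying
  in few members of a stage meets no further member until its piece changes, and by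
  well-foundedness its piece changes only finitely often along an increasing chain of stages.
  Hence in a filtration of the family by small closed stages the members at each point are
  essentially concentrated in a single layer, and one can color layer by layer, by induction on the
  cardinality of the family. The exception are the points lying in as many members as the whole
  family has, when this number is a successor cardinal; there are few pieces at such points, and
  they are handled by a transfinite greedy choice of countable subcovers.
\<close>

section \<open>Cardinalities\<close>

lemma countable_iff_ordLeq_nat: "countable A \<longleftrightarrow> |A| \<le>o |UNIV :: nat set|"
  unfolding countable_def card_of_ordLeq[symmetric] by simp

lemma card_of_not_ordLeq: "\<not> |A| \<le>o |B| \<Longrightarrow> |B| <o |A|"
  using not_ordLeq_iff_ordLess[OF card_of_Well_order card_of_Well_order] by blast

lemma card_of_not_ordLess: "\<not> |A| <o |B| \<Longrightarrow> |B| \<le>o |A|"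
  using not_ordLess_iff_ordLeq[OF card_of_Well_order card_of_Well_order] by blast

lemma countable_ordLeq_infinite:
  assumes "countable A" "infinite B"
  shows "|A| \<le>o |B|"
  using assms countable_iff_ordLeq_nat infinite_iff_card_of_nat ordLeq_transitive by blast

lemma uncountable_ordLess:
  assumes "countable A" "uncountable B"
  shows "|A| <o |B|"
  using assms by (meson card_of_Well_order countable_iff_ordLeq_nat not_ordLess_iff_ordLeq ordLeq_transitive)

lemma card_of_subset_ordLeq:
  assumes "A \<subseteq> B" "|B| \<le>o |C|"
  shows "|A| \<le>o |C|"
  using assms card_of_mono1 ordLeq_transitive by blast

lemma card_of_UN_ordLeq:
  assumes "infinite B" "|I| \<le>o |B|" "\<And>i. i \<in> I \<Longrightarrow> |A i| \<le>o |B|"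
  shows "|\<Union>i\<in>I. A i| \<le>o |B|"
  using card_of_UNION_ordLeq_infinite assms by blast

lemma card_of_Un_ordLeq:
  assumes "infinite B" "|A| \<le>o |B|" "|A'| \<le>o |B|"
  shows "|A \<union> A'| \<le>o |B|"
  using card_of_Un_ordLeq_infinite_Field[of "|B|" A A'] assms by (simp add: Field_card_of card_of_card_order_on)

text \<open>\<open>P n\<close> collects the results of n insertions into the empty set. Each level
  has at most |B| elements, every finite subset of \<open>A\<close> occurs at some level, and there
  are only countably many levels.\<close>

lemma card_of_Fpow_ordLeq:
  assumes "infinite B" "|A| \<le>o |B|"
  shows "|Fpow A| \<le>o |B|"
proof -
  define P where "P n = ((\<lambda>X. \<Union>a\<in>A. insert a ` X) ^^ n) {{}}" for n :: nat
  have P_Suc: "P (Suc n) = (\<Union>a\<in>A. insert a ` P n)" for n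
    by (simp add: P_def)
  have "|P n| \<le>o |B|" for n
  proof (induction n)
    case 0
    show ?case
      using assms(1) by (intro countable_ordLeq_infinite) (auto simp: P_def)
  next
    case (Suc n)
    show ?case
      unfolding P_Suc
      by (intro card_of_UN_ordLeq assms ordLeq_transitive[OF card_of_image Suc])
  qed
  then have "|\<Union>n. P n| \<le>o |B|"
    by - (rule card_of_UN_ordLeq[OF assms(1) countable_ordLeq_infinite[OF _ assms(1)]], simp_all)
  moreover have "\<exists>n. F \<in> P n" if "finite F" "F \<subseteq> A" for F
    using that
  proof (induction F rule: finite_induct)
    case empty
    have "{} \<in> P 0" by (simp add: P_def)
    then show ?case by blast
  next
    case (insert a F)
    then obtain n where "F \<in> P n" by auto
    then have "insert a F \<in> P (Suc n)"
      using insert.prems P_Suc by auto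
    then show ?case by blast
  qed
  then have "Fpow A \<subseteq> (\<Union>n. P n)"
    unfolding Fpow_def by blast
  ultimately show ?thesis
    by (metis card_of_subset_ordLeq)
qed

lemma card_of_subset_ordLess:
  assumes "A \<subseteq> B" "|B| <o |C|"
  shows "|A| <o |C|"
  using assms card_of_mono1 ordLeq_ordLess_trans by blast

section \<open>Initial segments of well-orders and transfinite recursion\<close>

lemma card_of_lessThan_mono:
  fixes \<alpha> \<beta> :: "'o::wellorder"
  assumes "\<alpha> \<le> \<beta>"
  shows "|{..<\<alpha>}| \<le>o |{..<\<beta>}|"
  using assms by (intro card_of_mono1) auto

lemma ordLess_lessThan_imp_less:
  fixes \<alpha> \<beta> :: "'o::wellorder"
  assumes "|{..<\<alpha>}| <o |{..<\<beta>}|"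
  shows "\<alpha> < \<beta>"
  using assms card_of_lessThan_mono not_ordLess_ordLeq by (metis not_le)

lemma card_of_inter_ordLess_cancel:
  assumes "infinite C" "\<not> |A| <o |C|" "|A \<inter> B| <o |C|"
  shows "\<not> |A - B| <o |C|"
proof
  assume "|A - B| <o |C|"
  then have "|(A - B) \<union> (A \<inter> B)| <o |C|"
    using assms card_of_Un_ordLess_infinite by blast
  then show False
    using assms(2) by (simp add: Un_Diff_Int)
qed

text \<open>The least element with infinitely many predecessors serves as omega: the segments below
  it are finite, and their sizes inject its own segment into the naturals. The same injection shows
  that such an element exists strictly below \<open>\<mu>\<close>.\<close>

lemma uncountable_lessThan_obtains_infinite:
  fixes \<mu> :: "'o::wellorder"
  assumes "uncountable {..<\<mu>}"
  obtains \<omega> where "\<omega> < \<mu>" "infinite {..<\<omega>}" "countable {..<\<omega>}"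
proof -
  have *: "countable {..<\<nu>}" if "\<And>\<alpha>. \<alpha> < \<nu> \<Longrightarrow> finite {..<\<alpha>}" for \<nu> :: 'o
  proof -
    have "inj_on (\<lambda>\<alpha>. card {..<\<alpha>}) {..<\<nu>}"
    proof (rule linorder_inj_onI)
      fix \<alpha> \<beta> assume "\<alpha> < \<beta>" "\<beta> \<in> {..<\<nu>}"
      then have "card {..<\<alpha>} < card {..<\<beta>}"
        using that by (intro psubset_card_mono) auto
      then show "card {..<\<alpha>} \<noteq> card {..<\<beta>}" by simp
    qed auto
    then show ?thesis by (rule countableI')
  qed
  obtain \<nu> where \<nu>: "\<nu> < \<mu>" "infinite {..<\<nu>}"
    using *[of \<mu>] assms by blast
  define \<omega> where "\<omega> = (LEAST \<omega> :: 'o. infinite {..<\<omega>})"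
  have "infinite {..<\<omega>}" "\<omega> \<le> \<nu>"
    unfolding \<omega>_def using \<nu>(2) by (rule LeastI, rule Least_le)
  moreover have "countable {..<\<omega>}"
    by (rule *) (use not_less_Least \<omega>_def in blast)
  ultimately show thesis
    using \<nu>(1) that le_less_trans by blast
qed

text \<open>Each value sees the earlier ones only through their union, that is, through what has
  been used up so far.\<close>

lemma greedy_recursion:
  fixes F :: "'o::wellorder \<Rightarrow> 'a set \<Rightarrow> 'a set"
  obtains E where "\<And>\<tau>. E \<tau> = F \<tau> (\<Union>\<sigma><\<tau>. E \<sigma>)"
proof -
  let ?R = "{(x, y). x < y} :: 'o rel"
  define E where "E = wfrec ?R (\<lambda>E \<tau>. F \<tau> (\<Union>\<sigma><\<tau>. E \<sigma>))"
  have cut: "(\<Union>\<sigma><\<tau>. cut E ?R \<tau> \<sigma>) = (\<Union>\<sigma><\<tau>. E \<sigma>)" for \<tau>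
    by (intro SUP_cong refl) (simp add: cut_apply)
  have "E \<tau> = F \<tau> (\<Union>\<sigma><\<tau>. cut E ?R \<tau> \<sigma>)" for \<tau>
    using wfrec[OF wf, of "\<lambda>E \<tau>. F \<tau> (\<Union>\<sigma><\<tau>. E \<sigma>)" \<tau>] by (simp only: E_def[symmetric])
  then have "E \<tau> = F \<tau> (\<Union>\<sigma><\<tau>. E \<sigma>)" for \<tau>
    unfolding cut .
  then show thesis by (rule that)
qed

section \<open>Traces on the pieces of the well-founded family\<close>

text \<open>A member of the cover is coded by a countable set \<open>D i\<close> of pairs \<open>(B, G)\<close>; it is the union
  of the sets \<open>B \<inter> G\<close>. If \<open>B\<close> is the smallest relevant member of \<open>\<B>\<close> at \<open>x\<close>, then \<open>x\<close> lies in
  the member \<open>i\<close> if and only if it lies in the open set \<open>open_trace D i B\<close>.\<close>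

definition open_trace :: "('k \<Rightarrow> ('x set \<times> 'x set) set) \<Rightarrow> 'k \<Rightarrow> 'x set \<Rightarrow> 'x set" where
  "open_trace D i B = \<Union>{G. \<exists>B'. (B', G) \<in> D i \<and> B \<subseteq> B'}"

definition members_at :: "('k \<Rightarrow> ('x set \<times> 'x set) set) \<Rightarrow> 'k set \<Rightarrow> 'x \<Rightarrow> 'k set" where
  "members_at D J x = {i \<in> J. \<exists>(B, G) \<in> D i. x \<in> B \<and> x \<in> G}"

definition bases :: "('k \<Rightarrow> ('x set \<times> 'x set) set) \<Rightarrow> 'k set \<Rightarrow> 'x set set" where
  "bases D M = (\<Union>i\<in>M. fst ` D i)"

text \<open>Finite intersections only, to keep their number small; by well-foundedness every piece
  is still one of them. The empty intersection \<open>UNIV\<close> is the piece of a point lying in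
  no member of \<open>bases D M\<close>.\<close>

definition meets :: "('k \<Rightarrow> ('x set \<times> 'x set) set) \<Rightarrow> 'k set \<Rightarrow> 'x set set" where
  "meets D M = Inter ` Fpow (bases D M)"

definition piece :: "('k \<Rightarrow> ('x set \<times> 'x set) set) \<Rightarrow> 'k set \<Rightarrow> 'x \<Rightarrow> 'x set" where
  "piece D M x = \<Inter>{B \<in> bases D M. x \<in> B}"

text \<open>For \<beta> below a cardinal \<kappa> \<le> |H(x)| one has |\<beta>| < |H(x)|, so this
  form yields goodness for all uncountable \<kappa> without mentioning cardinals. Colors may lie in
  any well-order.\<close>

definition uncountably_good ::
  "('k \<Rightarrow> ('x set \<times> 'x set) set) \<Rightarrow> 'k set \<Rightarrow> ('k \<Rightarrow> 'o::wellorder) \<Rightarrow> bool" where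
  "uncountably_good D J c \<longleftrightarrow>
    (\<forall>x \<beta>. uncountable (members_at D J x) \<and> |{..<\<beta>}| <o |members_at D J x|
      \<longrightarrow> \<beta> \<in> c ` members_at D J x)"

lemma members_at_mono: "M \<subseteq> J \<Longrightarrow> members_at D M x \<subseteq> members_at D J x"
  by (auto simp: members_at_def)

lemma members_at_subset: "members_at D M x \<subseteq> M"
  by (auto simp: members_at_def)

lemma members_at_UN: "members_at D (\<Union>\<zeta>\<in>Z. N \<zeta>) x = (\<Union>\<zeta>\<in>Z. members_at D (N \<zeta>) x)"
  by (auto simp: members_at_def)

lemma mem_piece: "x \<in> piece D M x"
  by (auto simp: piece_def)

lemma piece_antimono: "M \<subseteq> N \<Longrightarrow> piece D N x \<subseteq> piece D M x"
  by (auto simp: piece_def bases_def)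

lemma bases_mono: "M \<subseteq> N \<Longrightarrow> bases D M \<subseteq> bases D N"
  by (auto simp: bases_def)

lemma meets_mono: "M \<subseteq> N \<Longrightarrow> meets D M \<subseteq> meets D N"
  unfolding meets_def by (intro image_mono Fpow_mono bases_mono)

text \<open>A base that contains x and comes from an index in \<open>M\<close> contains the piece of
  x, so the set \<open>G\<close> paired with it contributes to the trace.\<close>

lemma members_at_open_trace: "i \<in> members_at D M x \<Longrightarrow> x \<in> open_trace D i (piece D M x)"
  unfolding members_at_def open_trace_def piece_def bases_def by force

lemma open_trace_members_at: "x \<in> open_trace D i B \<Longrightarrow> x \<in> B \<Longrightarrow> i \<in> J \<Longrightarrow> i \<in> members_at D J x"
  unfolding members_at_def open_trace_def by blast

text \<open>The topology enters only through \<open>Lindelof\<close>: countable subcovers for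
  arbitrary families of traces on a common \<open>B\<close>. This is where hereditary Lindelofness
  is used, as the union of the traces need not be the whole space.\<close>

locale coded_cover =
  fixes \<B> :: "'x set set" and D :: "'k \<Rightarrow> ('x set \<times> 'x set) set"
  assumes wf_\<B>: "well_founded_family \<B>"
    and Int_\<B>: "A \<in> \<B> \<Longrightarrow> B \<in> \<B> \<Longrightarrow> A \<inter> B \<in> \<B>"
    and base_\<B>: "(B, G) \<in> D i \<Longrightarrow> B \<in> \<B>"
    and countable_code: "countable (D i)"
    and Lindelof: "\<exists>C\<subseteq>S. countable C \<and> (\<Union>i\<in>S. open_trace D i B) \<subseteq> (\<Union>i\<in>C. open_trace D i B)"
begin

section \<open>Well-foundedness and minimal pieces\<close>

lemma bases_subset: "bases D M \<subseteq> \<B>"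
  using base_\<B> by (auto simp: bases_def)

lemma Inter_\<B>: "finite F \<Longrightarrow> F \<noteq> {} \<Longrightarrow> F \<subseteq> \<B> \<Longrightarrow> \<Inter>F \<in> \<B>"
  by (induction F rule: finite_ne_induct) (auto intro: Int_\<B>)

lemma minimal_\<B>:
  assumes "A \<subseteq> \<B>" "A \<noteq> {}"
  obtains M where "M \<in> A" "\<forall>B\<in>A. \<not> B \<subset> M"
  using assms wf_\<B> unfolding well_founded_family_def by meson

text \<open>By well-foundedness a finite subintersection is already the whole intersection.\<close>

lemma Inter_finite_subset:
  assumes "S \<subseteq> \<B>"
  obtains F where "finite F" "F \<subseteq> S" "\<Inter>F = \<Inter>S"
proof (cases "S = {}")
  case False
  let ?A = "{\<Inter>F |F. finite F \<and> F \<noteq> {} \<and> F \<subseteq> S}"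
  have "?A \<subseteq> \<B>"
    using assms Inter_\<B> by blast
  moreover have "?A \<noteq> {}"
  proof -
    obtain B where "B \<in> S" using False by blast
    then have "\<Inter>{B} \<in> ?A"
      by (intro CollectI exI[of _ "{B}"]) auto
    then show ?thesis by blast
  qed
  ultimately obtain M where M: "M \<in> ?A" "\<forall>B\<in>?A. \<not> B \<subset> M"
    by (elim minimal_\<B>[of ?A])
  then obtain F where F: "finite F" "F \<noteq> {}" "F \<subseteq> S" "M = \<Inter>F" by blast
  have "M \<subseteq> B" if "B \<in> S" for B
  proof -
    have "\<Inter>(insert B F) \<in> ?A"
      using F that by (intro CollectI exI[of _ "insert B F"]) auto
    with M(2) have "\<not> \<Inter>(insert B F) \<subset> M" by (rule bspec)
    then show ?thesis using F(4) by auto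
  qed
  then have "\<Inter>F = \<Inter>S" using F by blast
  then show thesis using F that by blast
qed (use that in blast)

lemma piece_meets: "piece D M x \<in> meets D M"
proof -
  have "{B \<in> bases D M. x \<in> B} \<subseteq> \<B>" using bases_subset by blast
  then obtain F where "finite F" "F \<subseteq> {B \<in> bases D M. x \<in> B}" "\<Inter>F = \<Inter>{B \<in> bases D M. x \<in> B}"
    by (rule Inter_finite_subset)
  then show ?thesis
    unfolding piece_def meets_def Fpow_def by (intro image_eqI[of _ _ F]) auto
qed

lemma meets_subset: "meets D M \<subseteq> insert UNIV \<B>"
  unfolding meets_def Fpow_def using Inter_\<B> bases_subset by fastforce

text \<open>\<open>UNIV\<close> may be a piece without lying in \<open>\<B>\<close>. It is a proper
  subset of nothing, so a minimal piece among those in \<open>\<B>\<close> is minimal among all; if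
  none lies in \<open>\<B>\<close>, all are \<open>UNIV\<close>.\<close>

lemma minimal_piece:
  assumes "Z \<noteq> {}"
  obtains \<zeta> where "\<zeta> \<in> Z" "\<And>\<zeta>'. \<zeta>' \<in> Z \<Longrightarrow> \<not> piece D (N \<zeta>') x \<subset> piece D (N \<zeta>) x"
proof (cases "(\<lambda>\<zeta>. piece D (N \<zeta>) x) ` Z \<inter> \<B> = {}")
  case True
  then have "piece D (N \<zeta>) x = UNIV" if "\<zeta> \<in> Z" for \<zeta>
    using meets_subset[of "N \<zeta>"] piece_meets[of "N \<zeta>" x] that by auto
  then show thesis using assms that by fastforce
next
  case False
  then obtain M where M: "M \<in> (\<lambda>\<zeta>. piece D (N \<zeta>) x) ` Z \<inter> \<B>"
    "\<forall>B \<in> (\<lambda>\<zeta>. piece D (N \<zeta>) x) ` Z \<inter> \<B>. \<not> B \<subset> M"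
    using minimal_\<B>[OF Int_lower2] by metis
  then obtain \<zeta> where \<zeta>: "\<zeta> \<in> Z" "M = piece D (N \<zeta>) x" by blast
  have "\<not> piece D (N \<zeta>') x \<subset> M" if "\<zeta>' \<in> Z" for \<zeta>'
    using meets_subset[of "N \<zeta>'"] piece_meets[of "N \<zeta>'" x] that M(2) by blast
  then show thesis using \<zeta> that by blast
qed

text \<open>Along a chain the pieces at \<open>x\<close> decrease, so they stabilise. If moreover all the stages are
  closed at \<open>x\<close>, then the members at \<open>x\<close> stabilise as well.\<close>

lemma members_at_stabilise:
  fixes N :: "'o::wellorder \<Rightarrow> 'k set"
  assumes "Z \<noteq> {}" and mono: "\<And>\<zeta> \<zeta>'. \<zeta> \<le> \<zeta>' \<Longrightarrow> N \<zeta> \<subseteq> N \<zeta>'"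
    and sub: "\<And>\<zeta>. N \<zeta> \<subseteq> J"
    and closed: "\<And>\<zeta> i. \<zeta> \<in> Z \<Longrightarrow> i \<in> J \<Longrightarrow> x \<in> open_trace D i (piece D (N \<zeta>) x) \<Longrightarrow> i \<in> N \<zeta>"
  obtains \<zeta> where "\<zeta> \<in> Z" "members_at D (\<Union>\<zeta>\<in>Z. N \<zeta>) x \<subseteq> members_at D (N \<zeta>) x"
proof -
  obtain \<zeta> where \<zeta>: "\<zeta> \<in> Z" "\<And>\<zeta>'. \<zeta>' \<in> Z \<Longrightarrow> \<not> piece D (N \<zeta>') x \<subset> piece D (N \<zeta>) x"
    using minimal_piece[OF assms(1), of N x] by metis
  have "members_at D (N \<zeta>') x \<subseteq> members_at D (N \<zeta>) x" if "\<zeta>' \<in> Z" for \<zeta>'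
  proof (cases "\<zeta>' \<le> \<zeta>")
    case True
    then show ?thesis using mono members_at_mono by metis
  next
    case False
    then have eq: "piece D (N \<zeta>') x = piece D (N \<zeta>) x"
      using \<zeta>(2)[OF that] piece_antimono[OF mono, of \<zeta> \<zeta>' D x] by (simp add: psubset_eq)
    show ?thesis
    proof
      fix i assume i: "i \<in> members_at D (N \<zeta>') x"
      then have tr: "x \<in> open_trace D i (piece D (N \<zeta>) x)"
        using members_at_open_trace eq by metis
      have "i \<in> J"
        by (rule subsetD[OF sub subsetD[OF members_at_subset i]])
      then have "i \<in> N \<zeta>" by (rule closed[OF \<zeta>(1) _ tr])
      then show "i \<in> members_at D (N \<zeta>) x"
        using open_trace_members_at tr mem_piece by metis
    qed
  qed
  then have "members_at D (\<Union>\<zeta>\<in>Z. N \<zeta>) x \<subseteq> members_at D (N \<zeta>) x"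
    unfolding members_at_UN by (rule UN_least)
  with \<zeta>(1) show thesis by (rule that)
qed

section \<open>Countable subcovers and closed stages\<close>

definition subcover :: "'x set \<Rightarrow> 'k set \<Rightarrow> 'k set" where
  "subcover B S = (SOME C. C \<subseteq> S \<and> countable C \<and> (\<Union>i\<in>S. open_trace D i B) \<subseteq> (\<Union>i\<in>C. open_trace D i B))"

lemma subcover:
  "subcover B S \<subseteq> S" "countable (subcover B S)"
  "i \<in> S \<Longrightarrow> x \<in> open_trace D i B \<Longrightarrow> \<exists>j\<in>subcover B S. x \<in> open_trace D j B"
proof -
  have "subcover B S \<subseteq> S \<and> countable (subcover B S) \<and>
      (\<Union>i\<in>S. open_trace D i B) \<subseteq> (\<Union>i\<in>subcover B S. open_trace D i B)"
    unfolding subcover_def by (rule someI_ex) (rule Lindelof)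
  then show "subcover B S \<subseteq> S" "countable (subcover B S)"
    "i \<in> S \<Longrightarrow> x \<in> open_trace D i B \<Longrightarrow> \<exists>j\<in>subcover B S. x \<in> open_trace D j B"
    by (auto dest: subsetD)
qed

text \<open>Codes are countable and only finite intersections are formed, so passing from indices to
  meets stays within an infinite cardinal.\<close>

lemma card_of_meets:
  assumes "infinite A" "|M| \<le>o |A|"
  shows "|meets D M| \<le>o |A|"
proof -
  have "|bases D M| \<le>o |A|"
    unfolding bases_def
    by (rule card_of_UN_ordLeq[OF assms])
      (rule countable_ordLeq_infinite[OF countable_image[OF countable_code] assms(1)])
  then have "|Fpow (bases D M)| \<le>o |A|"
    by (rule card_of_Fpow_ordLeq[OF assms(1)])
  moreover have "|meets D M| \<le>o |Fpow (bases D M)|"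
    unfolding meets_def by (rule card_of_image)
  ultimately show ?thesis using ordLeq_transitive by blast
qed

text \<open>A meet involves finitely many bases, and a finite subset of the union of a chain lies in
  one member of it. Hence omega rounds of closing off suffice to build a stage.\<close>

lemma meets_UN_incseq:
  assumes "incseq M" "B \<in> meets D (\<Union>n. M n)"
  obtains n :: nat where "B \<in> meets D (M n)"
proof -
  obtain F where F: "finite F" "F \<subseteq> (\<Union>n. bases D (M n))" "B = \<Inter>F"
    using assms(2) unfolding meets_def Fpow_def bases_def by auto
  have "incseq (\<lambda>n. bases D (M n))"
    using assms(1) by (auto simp: incseq_def intro!: bases_mono)
  then obtain n where "F \<subseteq> bases D (M n)"
  proof -
    have "subset.chain UNIV (range (\<lambda>n. bases D (M n)))"
      unfolding subset_chain_def using \<open>incseq (\<lambda>n. bases D (M n))\<close>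
      by (auto dest: incseqD) (meson incseqD linear subsetD)
    then show thesis
      using F(1,2) finite_subset_Union_chain[of F "range (\<lambda>n. bases D (M n))" UNIV] that by blast
  qed
  then show thesis
    using that F unfolding meets_def Fpow_def by blast
qed

text \<open>If \<open>x\<close> lies in few members of the stage \<open>N \<xi>\<close>, then one of the successive disjoint countable
  subcovers of its piece misses \<open>x\<close>, and hence nothing outside the stage has \<open>x\<close> in its trace.\<close>

lemma filtration:
  fixes h :: "'o::wellorder \<Rightarrow> 'k"
  obtains N :: "'o \<Rightarrow> 'k set" where
    "\<And>\<xi>. N \<xi> \<subseteq> J" "\<And>\<xi> \<xi>'. \<xi> \<le> \<xi>' \<Longrightarrow> N \<xi> \<subseteq> N \<xi>'" "\<And>\<xi>. h ` {..<\<xi>} \<inter> J \<subseteq> N \<xi>"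
    "\<And>\<xi>. infinite {..<\<xi>} \<Longrightarrow> |N \<xi>| \<le>o |{..<\<xi>}|"
    "\<And>\<xi> x i. |members_at D (N \<xi>) x| <o |{..<\<xi>}| \<Longrightarrow> i \<in> J \<Longrightarrow>
      x \<in> open_trace D i (piece D (N \<xi>) x) \<Longrightarrow> i \<in> N \<xi>"
proof -
  have "\<exists>E. \<forall>\<alpha> :: 'o. E \<alpha> = subcover B (J - (\<Union>\<beta><\<alpha>. E \<beta>))" for B
    using greedy_recursion[of "\<lambda>_ U. subcover B (J - U)"] by metis
  \<comment> \<open>\<open>C B \<alpha>\<close> is drawn from the indices not yet used for
    \<open>B\<close>, and its traces on \<open>B\<close> cover all that theirs cover. For fixed
    \<open>B\<close> these sets are pairwise disjoint.\<close>
  then obtain C :: "'x set \<Rightarrow> 'o \<Rightarrow> 'k set"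
    where C: "\<And>B \<alpha>. C B \<alpha> = subcover B (J - (\<Union>\<beta><\<alpha>. C B \<beta>))"
    by metis
  have C_sub: "C B \<alpha> \<subseteq> J - (\<Union>\<beta><\<alpha>. C B \<beta>)" and C_countable: "countable (C B \<alpha>)" for B \<alpha>
    using subcover(1,2) C by metis+
  \<comment> \<open>Each round adds the first \<xi> subcovers of every meet present. Taking \<xi> of
    them keeps the stage within |\<xi>| and monotone in \<xi>, yet forces |\<xi>| members at x if
    none of the subcovers for its piece misses x.\<close>
  define P where
    "P \<xi> n = ((\<lambda>M. M \<union> (\<Union>B\<in>meets D M. \<Union>\<alpha><\<xi>. C B \<alpha>)) ^^ n) (h ` {..<\<xi>} \<inter> J)" for \<xi> and n :: nat
  have P_0: "P \<xi> 0 = h ` {..<\<xi>} \<inter> J"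
    and P_Suc: "P \<xi> (Suc n) = P \<xi> n \<union> (\<Union>B\<in>meets D (P \<xi> n). \<Union>\<alpha><\<xi>. C B \<alpha>)" for \<xi> n
    by (simp_all add: P_def)
  define N where "N \<xi> = (\<Union>n. P \<xi> n)" for \<xi>
  have "P \<xi> n \<subseteq> J" for \<xi> n
  proof (induction n)
    case (Suc n)
    then show ?case using C_sub unfolding P_Suc by blast
  qed (simp add: P_0)
  then have N_J: "N \<xi> \<subseteq> J" for \<xi>
    by (auto simp: N_def)
  have "P \<xi> n \<subseteq> P \<xi>' n" if "\<xi> \<le> \<xi>'" for \<xi> \<xi>' n
  proof (induction n)
    case 0
    then show ?case using that by (auto simp: P_0)
  next
    case (Suc n)
    have "{..<\<xi>} \<subseteq> {..<\<xi>'}" using that by auto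
    then show ?case
      unfolding P_Suc using Suc meets_mono[OF Suc] by (intro Un_mono UN_mono subset_refl)
  qed
  then have N_mono: "N \<xi> \<subseteq> N \<xi>'" if "\<xi> \<le> \<xi>'" for \<xi> \<xi>'
    unfolding N_def using that by (intro UN_mono) auto
  have N_h: "h ` {..<\<xi>} \<inter> J \<subseteq> N \<xi>" for \<xi>
    unfolding N_def P_0[symmetric] by blast
  have N_card: "|N \<xi>| \<le>o |{..<\<xi>}|" if inf: "infinite {..<\<xi>}" for \<xi>
  proof -
    have "|P \<xi> n| \<le>o |{..<\<xi>}|" for n
    proof (induction n)
      case 0
      then show ?case
        unfolding P_0 by (rule card_of_subset_ordLeq[OF Int_lower1 card_of_image])
    next
      case (Suc n)
      have "|\<Union>\<alpha><\<xi>. C B \<alpha>| \<le>o |{..<\<xi>}|" for B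
        by (rule card_of_UN_ordLeq[OF inf card_of_mono1[OF subset_refl]])
          (rule countable_ordLeq_infinite[OF C_countable inf])
      then have "|\<Union>B\<in>meets D (P \<xi> n). \<Union>\<alpha><\<xi>. C B \<alpha>| \<le>o |{..<\<xi>}|"
        by (rule card_of_UN_ordLeq[OF inf card_of_meets[OF inf Suc]])
      then show ?case
        unfolding P_Suc by (rule card_of_Un_ordLeq[OF inf Suc])
    qed
    then show ?thesis
      unfolding N_def
      by (rule card_of_UN_ordLeq[OF inf countable_ordLeq_infinite[OF countableI_type inf]])
  qed
  have N_C: "C B \<alpha> \<subseteq> N \<xi>" if "B \<in> meets D (N \<xi>)" "\<alpha> < \<xi>" for B \<alpha> \<xi>
  proof -
    have "incseq (P \<xi>)"
      by (rule incseq_SucI) (auto simp: P_Suc)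
    then obtain n where "B \<in> meets D (P \<xi> n)"
      using \<open>B \<in> meets D (N \<xi>)\<close> unfolding N_def by (rule meets_UN_incseq)
    then have "C B \<alpha> \<subseteq> P \<xi> (Suc n)"
      unfolding P_Suc using that(2) by blast
    then show ?thesis
      unfolding N_def by blast
  qed
  have "i \<in> N \<xi>"
    if few: "|members_at D (N \<xi>) x| <o |{..<\<xi>}|" and i: "i \<in> J" "x \<in> open_trace D i (piece D (N \<xi>) x)"
    for \<xi> x i
  proof (rule ccontr)
    assume "i \<notin> N \<xi>"
    let ?B = "piece D (N \<xi>) x"
    have C_N: "C ?B \<alpha> \<subseteq> N \<xi>" if "\<alpha> < \<xi>" for \<alpha>
      using N_C[OF piece_meets that] .
    \<comment> \<open>Being outside the stage, \<open>i\<close> is still available at each of the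
      \<xi> choices for the piece of x, so every subcover has a trace containing x. Disjointness
      turns these into |\<xi>| different members at x.\<close>
    have "\<exists>j\<in>C ?B \<alpha>. x \<in> open_trace D j ?B" if "\<alpha> < \<xi>" for \<alpha>
    proof -
      have "i \<in> J - (\<Union>\<beta><\<alpha>. C ?B \<beta>)"
        using i(1) C_N \<open>i \<notin> N \<xi>\<close> that less_trans by blast
      then show ?thesis
        unfolding C[of ?B \<alpha>] by (rule subcover(3)[OF _ i(2)])
    qed
    then obtain f where f: "\<And>\<alpha>. \<alpha> < \<xi> \<Longrightarrow> f \<alpha> \<in> C ?B \<alpha> \<and> x \<in> open_trace D (f \<alpha>) ?B"
      by metis
    have "inj_on f {..<\<xi>}"
    proof (rule linorder_inj_onI)
      fix \<alpha> \<beta> assume "\<alpha> < \<beta>" "\<alpha> \<in> {..<\<xi>}" "\<beta> \<in> {..<\<xi>}"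
      then have "f \<alpha> \<in> (\<Union>\<gamma><\<beta>. C ?B \<gamma>)" "f \<beta> \<notin> (\<Union>\<gamma><\<beta>. C ?B \<gamma>)"
        using f C_sub by blast+
      then show "f \<alpha> \<noteq> f \<beta>" by metis
    qed auto
    moreover have "f ` {..<\<xi>} \<subseteq> members_at D (N \<xi>) x"
    proof (rule image_subsetI)
      fix \<alpha> assume "\<alpha> \<in> {..<\<xi>}"
      then have "x \<in> open_trace D (f \<alpha>) ?B" "f \<alpha> \<in> N \<xi>"
        using f C_N by blast+
      then show "f \<alpha> \<in> members_at D (N \<xi>) x"
        by (rule open_trace_members_at[OF _ mem_piece])
    qed
    ultimately have "|{..<\<xi>}| \<le>o |members_at D (N \<xi>) x|"
      by (intro card_of_ordLeq[THEN iffD1] exI conjI)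
    then show False
      using few not_ordLess_ordLeq by blast
  qed
  then show thesis
    by (intro that[of N] N_J N_mono N_h N_card)
qed

end

section \<open>The inductive construction of good colorings\<close>

definition stage_rank :: "'o::wellorder set \<Rightarrow> ('o \<Rightarrow> 'k set) \<Rightarrow> 'k \<Rightarrow> 'o" where
  "stage_rank \<Xi> N i = (LEAST \<xi>. \<xi> \<in> \<Xi> \<and> i \<in> N \<xi>)"

definition layer :: "'o::wellorder set \<Rightarrow> ('o \<Rightarrow> 'k set) \<Rightarrow> 'o \<Rightarrow> 'k set" where
  "layer \<Xi> N \<xi> = N \<xi> - (\<Union>\<zeta>\<in>\<Xi> \<inter> {..<\<xi>}. N \<zeta>)"

lemma stage_rank_layer:
  assumes "i \<in> layer \<Xi> N \<eta>" "\<eta> \<in> \<Xi>"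
  shows "stage_rank \<Xi> N i = \<eta>"
  unfolding stage_rank_def
proof (rule Least_equality)
  show "\<eta> \<in> \<Xi> \<and> i \<in> N \<eta>" using assms by (simp add: layer_def)
next
  fix \<zeta> assume "\<zeta> \<in> \<Xi> \<and> i \<in> N \<zeta>"
  then show "\<eta> \<le> \<zeta>" using assms by (force simp: layer_def)
qed

lemma stage_rank:
  assumes "i \<in> (\<Union>\<zeta>\<in>\<Xi>. N \<zeta>)"
  shows "stage_rank \<Xi> N i \<in> \<Xi>" "i \<in> N (stage_rank \<Xi> N i)"
proof -
  obtain \<zeta> where "\<zeta> \<in> \<Xi> \<and> i \<in> N \<zeta>" using assms by blast
  then have "stage_rank \<Xi> N i \<in> \<Xi> \<and> i \<in> N (stage_rank \<Xi> N i)"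
    unfolding stage_rank_def by (rule LeastI)
  then show "stage_rank \<Xi> N i \<in> \<Xi>" "i \<in> N (stage_rank \<Xi> N i)" by simp_all
qed

text \<open>Were all layers small at x, so would be every stage by induction, being covered by its
  layer and the union of the earlier stages. \<open>small\<close> stands for two notions: size at
  most a fixed cardinal in the limit case, and size below the number of members at x in the
  successor case.\<close>

lemma large_layer:
  fixes N :: "'o::wellorder \<Rightarrow> 'k set"
  assumes small_Un: "\<And>A B. small A \<Longrightarrow> small B \<Longrightarrow> small (A \<union> B)"
    and small_mono: "\<And>A B. A \<subseteq> B \<Longrightarrow> small B \<Longrightarrow> small A"
    and small_UN: "\<And>Z. Z \<subseteq> \<Xi> \<Longrightarrow> (\<And>\<zeta>. \<zeta> \<in> Z \<Longrightarrow> small (members_at D (N \<zeta>) x)) \<Longrightarrow>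
      small (members_at D (\<Union>\<zeta>\<in>Z. N \<zeta>) x)"
    and large: "\<not> small (members_at D (\<Union>\<zeta>\<in>\<Xi>. N \<zeta>) x)"
  shows "\<exists>\<eta>\<in>\<Xi>. \<not> small (members_at D (layer \<Xi> N \<eta>) x)"
proof (rule ccontr)
  assume "\<not> ?thesis"
  then have layers: "small (members_at D (layer \<Xi> N \<eta>) x)" if "\<eta> \<in> \<Xi>" for \<eta>
    using that by blast
  have "\<eta> \<in> \<Xi> \<Longrightarrow> small (members_at D (N \<eta>) x)" for \<eta>
  proof (induction \<eta> rule: less_induct)
    case (less \<eta>)
    have "small (members_at D (\<Union>\<zeta>\<in>\<Xi> \<inter> {..<\<eta>}. N \<zeta>) x)"
      by (rule small_UN) (use less.IH in auto)
    then have "small (members_at D (layer \<Xi> N \<eta>) x \<union> members_at D (\<Union>\<zeta>\<in>\<Xi> \<inter> {..<\<eta>}. N \<zeta>) x)"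
      by (rule small_Un[OF layers[OF less.prems]])
    then show ?case
      by (rule small_mono[rotated]) (auto simp: members_at_def layer_def)
  qed
  then show False
    using small_UN[OF subset_refl] large by blast
qed

lemma uncountably_good_countable: "countable J \<Longrightarrow> uncountably_good D J c"
  unfolding uncountably_good_def using members_at_subset countable_subset by metis

lemma uncountably_goodD:
  assumes "uncountably_good D J c" "uncountable (members_at D J x)" "|{..<\<beta>}| <o |members_at D J x|"
  shows "\<beta> \<in> c ` members_at D J x"
  using assms unfolding uncountably_good_def by blast

context coded_cover
begin

text \<open>The stages are indexed by the infinite cardinals below \<open>\<mu>\<close>.\<close>

lemma limit_step:
  fixes \<mu> :: "'o::wellorder" and h :: "'o \<Rightarrow> 'k"
  assumes h: "h ` {..<\<mu>} = J" and J: "uncountable J"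
    and limit: "\<And>\<nu>. \<nu> < \<mu> \<Longrightarrow> infinite {..<\<nu>} \<Longrightarrow> \<exists>\<xi><\<mu>. |{..<\<nu>}| <o |{..<\<xi>}|"
    and IH: "\<And>K \<xi>. \<xi> < \<mu> \<Longrightarrow> |K| \<le>o |{..<\<xi>}| \<Longrightarrow> \<exists>c :: 'k \<Rightarrow> 'o. uncountably_good D K c"
  shows "\<exists>c :: 'k \<Rightarrow> 'o. uncountably_good D J c"
proof -
  obtain N where N: "\<And>\<xi>. N \<xi> \<subseteq> J" "\<And>\<xi> \<xi>'. \<xi> \<le> \<xi>' \<Longrightarrow> N \<xi> \<subseteq> N \<xi>'" "\<And>\<xi>. h ` {..<\<xi>} \<inter> J \<subseteq> N \<xi>"
    and N_card: "\<And>\<xi>. infinite {..<\<xi>} \<Longrightarrow> |N \<xi>| \<le>o |{..<\<xi>}|"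
    and N_closed: "\<And>\<xi> x i. |members_at D (N \<xi>) x| <o |{..<\<xi>}| \<Longrightarrow> i \<in> J \<Longrightarrow>
      x \<in> open_trace D i (piece D (N \<xi>) x) \<Longrightarrow> i \<in> N \<xi>"
    by (rule filtration[of J h]) blast
  define \<Xi> where "\<Xi> = {\<xi>. \<xi> < \<mu> \<and> infinite {..<\<xi>} \<and> (\<forall>\<alpha><\<xi>. |{..<\<alpha>}| <o |{..<\<xi>}| )}"
  have J_\<mu>: "|J| \<le>o |{..<\<mu>}|"
    using card_of_image[of h "{..<\<mu>}"] h by simp
  have "uncountable {..<\<mu>}"
    using J h countable_image by blast
  then obtain \<omega> where \<omega>: "\<omega> < \<mu>" "infinite {..<\<omega>}" "countable {..<\<omega>}"
    by (rule uncountable_lessThan_obtains_infinite)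
  have \<Xi>_unbounded: "\<exists>\<xi>\<in>\<Xi>. \<nu> < \<xi>" if \<nu>: "\<nu> < \<mu>" "infinite {..<\<nu>}" for \<nu>
  proof -
    obtain \<zeta> where \<zeta>: "\<zeta> < \<mu>" "|{..<\<nu>}| <o |{..<\<zeta>}|"
      using limit[OF \<nu>] by blast
    \<comment> \<open>This is the successor cardinal of |\<nu>|; the witness \<open>\<zeta>\<close>
      keeps it below \<open>\<mu>\<close>.\<close>
    define \<xi> where "\<xi> = (LEAST \<xi> :: 'o. |{..<\<nu>}| <o |{..<\<xi>}| )"
    have \<xi>: "|{..<\<nu>}| <o |{..<\<xi>}|" "\<xi> \<le> \<zeta>"
      unfolding \<xi>_def using \<zeta>(2) by (rule LeastI, rule Least_le)
    have "\<nu> < \<xi>"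
      using \<xi>(1) by (rule ordLess_lessThan_imp_less)
    have "|{..<\<alpha>}| <o |{..<\<xi>}|" if "\<alpha> < \<xi>" for \<alpha>
    proof -
      have "\<not> |{..<\<nu>}| <o |{..<\<alpha>}|"
        using that not_less_Least unfolding \<xi>_def by blast
      then have "|{..<\<alpha>}| \<le>o |{..<\<nu>}|"
        using card_of_not_ordLess by blast
      then show ?thesis
        using \<xi>(1) ordLeq_ordLess_trans by blast
    qed
    moreover have "infinite {..<\<xi>}"
      using \<nu>(2) \<open>\<nu> < \<xi>\<close> by (meson finite_subset lessThan_subset_iff less_imp_le)
    ultimately have "\<xi> \<in> \<Xi>"
      using \<xi>(2) \<zeta>(1) by (auto simp: \<Xi>_def)
    then show ?thesis using \<open>\<nu> < \<xi>\<close> by blast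
  qed
  have J_eq: "J = (\<Union>\<xi>\<in>\<Xi>. N \<xi>)"
  proof
    show "J \<subseteq> (\<Union>\<xi>\<in>\<Xi>. N \<xi>)"
    proof
      fix i assume "i \<in> J"
      then obtain \<alpha> where \<alpha>: "\<alpha> < \<mu>" "i = h \<alpha>" using h by blast
      have "infinite {..<max \<alpha> \<omega>}"
        using \<omega>(2) by (meson finite_subset lessThan_subset_iff max.cobounded2)
      then obtain \<xi> where "\<xi> \<in> \<Xi>" "max \<alpha> \<omega> < \<xi>"
        using \<Xi>_unbounded \<alpha>(1) \<omega>(1) by (metis max_less_iff_conj)
      then show "i \<in> (\<Union>\<xi>\<in>\<Xi>. N \<xi>)"
        using N(3)[of \<xi>] \<alpha>(2) \<open>i \<in> J\<close> by auto
    qed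
  qed (use N(1) in blast)
  have "\<exists>c :: 'k \<Rightarrow> 'o. uncountably_good D (layer \<Xi> N \<eta>) c" if "\<eta> \<in> \<Xi>" for \<eta>
  proof (rule IH)
    show "\<eta> < \<mu>" using that by (simp add: \<Xi>_def)
    show "|layer \<Xi> N \<eta>| \<le>o |{..<\<eta>}|"
      unfolding layer_def
      by (rule card_of_subset_ordLeq[OF Diff_subset N_card]) (use that in \<open>simp add: \<Xi>_def\<close>)
  qed
  then obtain c :: "'o \<Rightarrow> 'k \<Rightarrow> 'o" where c: "\<And>\<eta>. \<eta> \<in> \<Xi> \<Longrightarrow> uncountably_good D (layer \<Xi> N \<eta>) (c \<eta>)"
    by metis
  \<comment> \<open>Each index takes its color from the coloring of the one layer that contains
    it.\<close>
  have "\<beta> \<in> (\<lambda>i. c (stage_rank \<Xi> N i) i) ` members_at D J x"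
    if x: "uncountable (members_at D J x)" and \<beta>: "|{..<\<beta>}| <o |members_at D J x|" for x \<beta>
  proof -
    \<comment> \<open>An infinite bound for \<beta>, still of smaller size than the set of members
      at x. A layer with more than |\<theta>| members at x is uncountable there and shows
      \<beta>.\<close>
    define \<theta> where "\<theta> = max \<beta> \<omega>"
    have "|members_at D J x| \<le>o |{..<\<mu>}|"
      by (rule card_of_subset_ordLeq[OF members_at_subset J_\<mu>])
    then have "\<beta> < \<mu>"
      using \<beta> ordLess_lessThan_imp_less ordLess_ordLeq_trans by blast
    have "\<theta> < \<mu>" using \<open>\<beta> < \<mu>\<close> \<omega>(1) by (simp add: \<theta>_def)
    have inf: "infinite {..<\<theta>}"
      using \<omega>(2) unfolding \<theta>_def by (meson finite_subset lessThan_subset_iff max.cobounded2)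
    have \<theta>_less: "|{..<\<theta>}| <o |members_at D J x|"
      using \<beta> uncountable_ordLess[OF \<omega>(3) x] unfolding \<theta>_def max_def by simp
    \<comment> \<open>Stages up to \<theta> lie in \<open>N \<theta>\<close>, of size at most
      |\<theta>|. A stage beyond \<theta> is indexed by a cardinal above |\<theta>|, so if small at
      x it is closed at x. Once such a stage \<open>\<zeta>1\<close> occurs, it absorbs the earlier
      ones and stabilisation applies to the rest.\<close>
    have small_UN: "|members_at D (\<Union>\<zeta>\<in>Z. N \<zeta>) x| \<le>o |{..<\<theta>}|"
      if Z: "Z \<subseteq> \<Xi>" and small: "\<And>\<zeta>. \<zeta> \<in> Z \<Longrightarrow> |members_at D (N \<zeta>) x| \<le>o |{..<\<theta>}|" for Z
    proof (cases "\<forall>\<zeta>\<in>Z. \<zeta> \<le> \<theta>")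
      case True
      then have "(\<Union>\<zeta>\<in>Z. N \<zeta>) \<subseteq> N \<theta>"
        using N(2) by blast
      then have "members_at D (\<Union>\<zeta>\<in>Z. N \<zeta>) x \<subseteq> N \<theta>"
        using members_at_subset by (rule subset_trans[rotated])
      then show ?thesis
        using N_card[OF inf] by (rule card_of_subset_ordLeq)
    next
      case False
      then obtain \<zeta>1 where \<zeta>1: "\<zeta>1 \<in> Z" "\<theta> < \<zeta>1" by force
      define Z' where "Z' = Z \<inter> {\<zeta>1..}"
      have "(\<Union>\<zeta>\<in>Z. N \<zeta>) \<subseteq> (\<Union>\<zeta>\<in>Z'. N \<zeta>)"
      proof (rule UN_least)
        fix \<zeta> assume "\<zeta> \<in> Z"
        show "N \<zeta> \<subseteq> (\<Union>\<zeta>\<in>Z'. N \<zeta>)"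
        proof (cases "\<zeta> \<le> \<zeta>1")
          case True
          then show ?thesis using N(2)[OF True] \<zeta>1(1) by (auto simp: Z'_def)
        qed (use \<open>\<zeta> \<in> Z\<close> in \<open>auto simp: Z'_def\<close>)
      qed
      have "Z' \<noteq> {}" using \<zeta>1(1) by (auto simp: Z'_def)
      moreover have "i \<in> N \<zeta>"
        if \<zeta>: "\<zeta> \<in> Z'" and i: "i \<in> J" "x \<in> open_trace D i (piece D (N \<zeta>) x)" for \<zeta> i
      proof (rule N_closed[OF _ i])
        have "\<zeta> \<in> \<Xi>" "\<theta> < \<zeta>" "\<zeta> \<in> Z"
          using \<zeta> Z \<zeta>1(2) by (auto simp: Z'_def)
        then show "|members_at D (N \<zeta>) x| <o |{..<\<zeta>}|"
          using small ordLeq_ordLess_trans unfolding \<Xi>_def by blast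
      qed
      ultimately obtain \<zeta> where "\<zeta> \<in> Z'" "members_at D (\<Union>\<zeta>\<in>Z'. N \<zeta>) x \<subseteq> members_at D (N \<zeta>) x"
        using members_at_stabilise[of Z' N J x] N(1,2) by blast
      note this(2)
      with members_at_mono[OF \<open>(\<Union>\<zeta>\<in>Z. N \<zeta>) \<subseteq> (\<Union>\<zeta>\<in>Z'. N \<zeta>)\<close>]
      have "members_at D (\<Union>\<zeta>\<in>Z. N \<zeta>) x \<subseteq> members_at D (N \<zeta>) x"
        by (rule subset_trans)
      then show ?thesis
        by (rule card_of_subset_ordLeq) (use small \<open>\<zeta> \<in> Z'\<close> in \<open>simp add: Z'_def\<close>)
    qed
    have "\<exists>\<eta>\<in>\<Xi>. \<not> |members_at D (layer \<Xi> N \<eta>) x| \<le>o |{..<\<theta>}|"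
    proof (rule large_layer[of "\<lambda>S. |S| \<le>o |{..<\<theta>}|" \<Xi> D N x])
      show "\<not> |members_at D (\<Union>\<zeta>\<in>\<Xi>. N \<zeta>) x| \<le>o |{..<\<theta>}|"
        using \<theta>_less J_eq not_ordLess_ordLeq by metis
    qed (fact card_of_Un_ordLeq[OF inf], fact card_of_subset_ordLeq, fact small_UN)
    then obtain \<eta> where \<eta>: "\<eta> \<in> \<Xi>" "\<not> |members_at D (layer \<Xi> N \<eta>) x| \<le>o |{..<\<theta>}|"
      by blast
    have "\<beta> \<in> c \<eta> ` members_at D (layer \<Xi> N \<eta>) x"
    proof (rule uncountably_goodD[OF c[OF \<eta>(1)]])
      show "uncountable (members_at D (layer \<Xi> N \<eta>) x)"
        using \<eta>(2) inf countable_ordLeq_infinite by blast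
      have "|{..<\<beta>}| \<le>o |{..<\<theta>}|"
        by (rule card_of_lessThan_mono) (simp add: \<theta>_def)
      moreover have "|{..<\<theta>}| <o |members_at D (layer \<Xi> N \<eta>) x|"
        using \<eta>(2) by (rule card_of_not_ordLeq)
      ultimately show "|{..<\<beta>}| <o |members_at D (layer \<Xi> N \<eta>) x|"
        by (rule ordLeq_ordLess_trans)
    qed
    then obtain i where i: "i \<in> members_at D (layer \<Xi> N \<eta>) x" "\<beta> = c \<eta> i" by blast
    have "i \<in> layer \<Xi> N \<eta>"
      using i(1) by (rule subsetD[OF members_at_subset])
    then have "stage_rank \<Xi> N i = \<eta>"
      using \<eta>(1) by (rule stage_rank_layer)
    moreover have "layer \<Xi> N \<eta> \<subseteq> J"
      using N(1) unfolding layer_def by blast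
    then have "i \<in> members_at D J x"
      by (rule subsetD[OF members_at_mono i(1)])
    ultimately show ?thesis using i(2) by blast
  qed
  then have "uncountably_good D J (\<lambda>i. c (stage_rank \<Xi> N i) i)"
    unfolding uncountably_good_def by blast
  then show ?thesis by blast
qed

text \<open>Here \<open>\<mu>\<close> is the successor cardinal of \<open>\<nu>\<close>. The points in \<open>\<mu>\<close> many members receive their
  colors from a family \<open>F\<close> chosen greedily, always of larger rank than before. So \<open>F\<close> meets each
  layer in a countable set, and removing it does no harm to the other points.\<close>

lemma successor_step:
  fixes \<mu> \<nu> :: "'o::wellorder" and h :: "'o \<Rightarrow> 'k"
  assumes h: "h ` {..<\<mu>} = J" and J: "uncountable J"
    and \<nu>: "\<nu> < \<mu>" "infinite {..<\<nu>}" "|{..<\<nu>}| <o |J|"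
    and succ: "\<And>\<xi>. \<xi> < \<mu> \<Longrightarrow> |{..<\<xi>}| \<le>o |{..<\<nu>}|"
    and IH: "\<And>K \<xi>. \<xi> < \<mu> \<Longrightarrow> |K| \<le>o |{..<\<xi>}| \<Longrightarrow> \<exists>c :: 'k \<Rightarrow> 'o. uncountably_good D K c"
  shows "\<exists>c :: 'k \<Rightarrow> 'o. uncountably_good D J c"
proof -
  obtain N where N: "\<And>\<xi>. N \<xi> \<subseteq> J" "\<And>\<xi> \<xi>'. \<xi> \<le> \<xi>' \<Longrightarrow> N \<xi> \<subseteq> N \<xi>'" "\<And>\<xi>. h ` {..<\<xi>} \<inter> J \<subseteq> N \<xi>"
    and N_card: "\<And>\<xi>. infinite {..<\<xi>} \<Longrightarrow> |N \<xi>| \<le>o |{..<\<xi>}|"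
    and N_closed: "\<And>\<xi> x i. |members_at D (N \<xi>) x| <o |{..<\<xi>}| \<Longrightarrow> i \<in> J \<Longrightarrow>
      x \<in> open_trace D i (piece D (N \<xi>) x) \<Longrightarrow> i \<in> N \<xi>"
    by (rule filtration[of J h]) blast
  \<comment> \<open>Starting at \<open>\<nu>\<close> gives all stage indices the same cardinality
    |\<nu>|, the largest one below \<open>\<mu>\<close>.\<close>
  define \<Xi> where "\<Xi> = {\<nu>..<\<mu>}"
  have J_\<mu>: "|J| \<le>o |{..<\<mu>}|"
    using card_of_image[of h "{..<\<mu>}"] h by simp
  have inf_\<mu>: "infinite {..<\<mu>}"
    using J h countable_finite countable_image by blast
  have inf: "infinite {..<\<xi>}" if "\<nu> \<le> \<xi>" for \<xi>
    using \<nu>(2) that by (meson finite_subset lessThan_subset_iff)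
  \<comment> \<open>Regularity of a successor cardinal: |\<nu>| many segments of size at most
    |\<nu>| do not exhaust \<open>\<mu>\<close>. Inserting \<open>\<nu>\<close> puts the bound into
    \<open>\<Xi>\<close>, and closed segments make it strict.\<close>
  have bounded: "\<exists>\<xi>\<in>\<Xi>. \<forall>\<alpha>\<in>U. \<alpha> < \<xi>" if U: "U \<subseteq> {..<\<mu>}" "|U| \<le>o |{..<\<nu>}|" for U
  proof -
    have "|insert \<nu> U| \<le>o |{..<\<nu>}|"
      using card_of_Un_ordLeq[OF \<nu>(2) countable_ordLeq_infinite[OF _ \<nu>(2), of "{\<nu>}"] U(2)] by simp
    moreover have "|{..\<alpha>}| \<le>o |{..<\<nu>}|" if "\<alpha> \<in> insert \<nu> U" for \<alpha>
    proof -
      have "|{..<\<alpha>}| \<le>o |{..<\<nu>}|" using that U(1) \<nu>(1) succ by blast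
      then have "|{..<\<alpha>} \<union> {\<alpha>}| \<le>o |{..<\<nu>}|"
        by (rule card_of_Un_ordLeq[OF \<nu>(2) _ countable_ordLeq_infinite[OF _ \<nu>(2)]]) simp
      moreover have "{..<\<alpha>} \<union> {\<alpha>} = {..\<alpha>}" by auto
      ultimately show ?thesis by simp
    qed
    ultimately have "|\<Union>\<alpha>\<in>insert \<nu> U. {..\<alpha>}| \<le>o |{..<\<nu>}|"
      by (rule card_of_UN_ordLeq[OF \<nu>(2)])
    moreover have "|{..<\<nu>}| <o |{..<\<mu>}|"
      using \<nu>(3) J_\<mu> by (rule ordLess_ordLeq_trans)
    ultimately have "\<not> {..<\<mu>} \<subseteq> (\<Union>\<alpha>\<in>insert \<nu> U. {..\<alpha>})"
      using card_of_subset_ordLeq not_ordLess_ordLeq by blast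
    then obtain \<xi> where "\<xi> < \<mu>" "\<xi> \<notin> (\<Union>\<alpha>\<in>insert \<nu> U. {..\<alpha>})"
      by auto
    then have "\<xi> \<in> \<Xi>" "\<forall>\<alpha>\<in>U. \<alpha> < \<xi>"
      by (auto simp: \<Xi>_def not_le)
    then show ?thesis by blast
  qed
  have J_eq: "J = (\<Union>\<xi>\<in>\<Xi>. N \<xi>)"
  proof
    show "J \<subseteq> (\<Union>\<xi>\<in>\<Xi>. N \<xi>)"
    proof
      fix i assume "i \<in> J"
      then obtain \<alpha> where \<alpha>: "\<alpha> < \<mu>" "i = h \<alpha>" using h by blast
      then obtain \<xi> where "\<xi> \<in> \<Xi>" "\<alpha> < \<xi>"
        using bounded[of "{\<alpha>}"] countable_ordLeq_infinite[OF _ \<nu>(2), of "{\<alpha>}"] by auto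
      then show "i \<in> (\<Union>\<xi>\<in>\<Xi>. N \<xi>)"
        using N(3)[of \<xi>] \<alpha>(2) \<open>i \<in> J\<close> by auto
    qed
  qed (use N(1) in blast)
  have N_\<nu>: "|N \<xi>| \<le>o |{..<\<nu>}|" if "\<xi> \<in> \<Xi>" for \<xi>
    using ordLeq_transitive[OF N_card[OF inf] succ] that by (simp add: \<Xi>_def)
  \<comment> \<open>A task is a pair of a meet and a color. There are at most |\<mu>| tasks, so
    \<open>g\<close> lists them all along \<open>\<mu>\<close>, possibly with repetitions.\<close>
  have "|meets D J \<times> {..<\<mu>}| \<le>o |{..<\<mu>}|"
    using inf_\<mu> card_of_meets[OF inf_\<mu> J_\<mu>]
    by (intro card_of_Sigma_ordLeq_infinite ballI card_of_mono1 subset_refl)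
  moreover have "meets D J \<times> {..<\<mu>} \<noteq> {}"
    using piece_meets[of J undefined] \<nu>(1) by blast
  ultimately obtain g where g: "g ` {..<\<mu>} = meets D J \<times> {..<\<mu>}"
    using card_of_ordLeq2 by metis
  let ?rank = "stage_rank \<Xi> N"
  define S where "S U = {i \<in> J. \<forall>j\<in>U. ?rank j < ?rank i}" for U
  obtain E where E: "\<And>\<tau>. E \<tau> = subcover (fst (g \<tau>)) (S (\<Union>\<sigma><\<tau>. E \<sigma>))"
    using greedy_recursion[of "\<lambda>\<tau> U. subcover (fst (g \<tau>)) (S U)"] by metis
  have E_sub: "E \<tau> \<subseteq> S (\<Union>\<sigma><\<tau>. E \<sigma>)" and E_countable: "countable (E \<tau>)" for \<tau>
    using subcover(1,2) E by metis+
  have E_J: "E \<tau> \<subseteq> J" for \<tau>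
    using E_sub[of \<tau>] by (auto simp: S_def)
  have E_rank: "?rank j < ?rank i" if "\<sigma> < \<tau>" "j \<in> E \<sigma>" "i \<in> E \<tau>" for \<sigma> \<tau> i j
    using E_sub[of \<tau>] that by (auto simp: S_def)
  have E_unique: "\<sigma> = \<tau>" if "j \<in> E \<sigma>" "i \<in> E \<tau>" "?rank j = ?rank i" for \<sigma> \<tau> i j
    using E_rank[of \<sigma> \<tau> j i] E_rank[of \<tau> \<sigma> i j] that by (cases \<sigma> \<tau> rule: linorder_cases) auto
  define F where "F = (\<Union>\<tau><\<mu>. E \<tau>)"
  have F_layer: "countable (layer \<Xi> N \<eta> \<inter> F)" if "\<eta> \<in> \<Xi>" for \<eta>
  proof (cases "layer \<Xi> N \<eta> \<inter> F = {}")
    case False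
    then obtain i \<tau> where i: "i \<in> layer \<Xi> N \<eta>" "i \<in> E \<tau>" by (auto simp: F_def)
    have "layer \<Xi> N \<eta> \<inter> F \<subseteq> E \<tau>"
    proof
      fix j assume "j \<in> layer \<Xi> N \<eta> \<inter> F"
      then obtain \<sigma> where j: "j \<in> layer \<Xi> N \<eta>" "j \<in> E \<sigma>" by (auto simp: F_def)
      then have "\<sigma> = \<tau>"
        using E_unique[OF j(2) i(2)] stage_rank_layer that i(1) by metis
      then show "j \<in> E \<tau>" using j by simp
    qed
    then show ?thesis using E_countable countable_subset by blast
  qed simp
  have "\<exists>c :: 'k \<Rightarrow> 'o. uncountably_good D (layer \<Xi> N \<eta> - F) c" if "\<eta> \<in> \<Xi>" for \<eta>
  proof (rule IH)
    show "\<nu> < \<mu>" by (rule \<nu>(1))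
    show "|layer \<Xi> N \<eta> - F| \<le>o |{..<\<nu>}|"
      using N_\<nu>[OF that] by (rule card_of_subset_ordLeq[rotated]) (auto simp: layer_def)
  qed
  then obtain c :: "'o \<Rightarrow> 'k \<Rightarrow> 'o"
    where c: "\<And>\<eta>. \<eta> \<in> \<Xi> \<Longrightarrow> uncountably_good D (layer \<Xi> N \<eta> - F) (c \<eta>)"
    by metis
  \<comment> \<open>An index in \<open>F\<close> gets the color of the task it serves, which is
    unique because ranks strictly increase from task to task. Elsewhere the coloring of the layer
    without \<open>F\<close> applies.\<close>
  define col where
    "col i = (if i \<in> F then snd (g (THE \<tau>. i \<in> E \<tau>)) else c (?rank i) i)" for i
  have col_E: "col i = snd (g \<tau>)" if "\<tau> < \<mu>" "i \<in> E \<tau>" for i \<tau>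
  proof -
    have "(THE \<tau>. i \<in> E \<tau>) = \<tau>"
      using that(2) E_unique by (intro the_equality) auto
    moreover have "i \<in> F" using that by (auto simp: F_def)
    ultimately show ?thesis by (simp add: col_def)
  qed
  have "\<beta> \<in> col ` members_at D J x"
    if x: "uncountable (members_at D J x)" and \<beta>: "|{..<\<beta>}| <o |members_at D J x|" for x \<beta>
  proof (cases "|members_at D J x| \<le>o |{..<\<nu>}|")
    case True
    let ?A = "members_at D J x"
    have inf_A: "infinite ?A" using x countable_finite by blast
    \<comment> \<open>Here |?A| \<le> |\<nu>|, so a stage with fewer than |?A| members at x has
      fewer than its index requires; it is therefore closed at x and stabilisation applies.\<close>
    have small_UN: "|members_at D (\<Union>\<zeta>\<in>Z. N \<zeta>) x| <o |?A|"
      if Z: "Z \<subseteq> \<Xi>" and small: "\<And>\<zeta>. \<zeta> \<in> Z \<Longrightarrow> |members_at D (N \<zeta>) x| <o |?A|" for Z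
    proof (cases "Z = {}")
      case True
      then show ?thesis
        using uncountable_ordLess[OF _ x, of "{}"] by (simp add: members_at_def)
    next
      case False
      moreover have "i \<in> N \<zeta>"
        if \<zeta>: "\<zeta> \<in> Z" and i: "i \<in> J" "x \<in> open_trace D i (piece D (N \<zeta>) x)" for \<zeta> i
      proof (rule N_closed[OF _ i])
        have "\<nu> \<le> \<zeta>" using \<zeta> Z by (auto simp: \<Xi>_def)
        then have "|?A| \<le>o |{..<\<zeta>}|"
          using True card_of_lessThan_mono ordLeq_transitive by blast
        then show "|members_at D (N \<zeta>) x| <o |{..<\<zeta>}|"
          by (rule ordLess_ordLeq_trans[OF small[OF \<zeta>]])
      qed
      ultimately obtain \<zeta> where "\<zeta> \<in> Z" "members_at D (\<Union>\<zeta>\<in>Z. N \<zeta>) x \<subseteq> members_at D (N \<zeta>) x"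
        using members_at_stabilise[of Z N J x] N(1,2) by blast
      then show ?thesis
        using small card_of_subset_ordLess by metis
    qed
    have "\<exists>\<eta>\<in>\<Xi>. \<not> |members_at D (layer \<Xi> N \<eta>) x| <o |?A|"
    proof (rule large_layer[of "\<lambda>S. |S| <o |?A|" \<Xi> D N x])
      show "\<not> |members_at D (\<Union>\<zeta>\<in>\<Xi>. N \<zeta>) x| <o |?A|"
        unfolding J_eq[symmetric] using ordLess_irreflexive by blast
    qed (fact card_of_Un_ordLess_infinite[OF inf_A], fact card_of_subset_ordLess, fact small_UN)
    then obtain \<eta> where \<eta>: "\<eta> \<in> \<Xi>" "\<not> |members_at D (layer \<Xi> N \<eta>) x| <o |?A|"
      by blast
    have "countable (members_at D (layer \<Xi> N \<eta>) x \<inter> F)"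
      using F_layer[OF \<eta>(1)] by (rule countable_subset[rotated]) (auto simp: members_at_def)
    then have "\<not> |members_at D (layer \<Xi> N \<eta>) x - F| <o |?A|"
      using card_of_inter_ordLess_cancel[OF inf_A \<eta>(2)] uncountable_ordLess[OF _ x] by blast
    moreover have "members_at D (layer \<Xi> N \<eta>) x - F = members_at D (layer \<Xi> N \<eta> - F) x"
      by (auto simp: members_at_def)
    ultimately have large: "\<not> |members_at D (layer \<Xi> N \<eta> - F) x| <o |?A|"
      by simp
    have "\<beta> \<in> c \<eta> ` members_at D (layer \<Xi> N \<eta> - F) x"
    proof (rule uncountably_goodD[OF c[OF \<eta>(1)]])
      show "uncountable (members_at D (layer \<Xi> N \<eta> - F) x)"
        using large uncountable_ordLess[OF _ x] by blast
      have "|?A| \<le>o |members_at D (layer \<Xi> N \<eta> - F) x|"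
        using large by (rule card_of_not_ordLess)
      with \<beta> show "|{..<\<beta>}| <o |members_at D (layer \<Xi> N \<eta> - F) x|"
        by (rule ordLess_ordLeq_trans)
    qed
    then obtain i where i: "i \<in> members_at D (layer \<Xi> N \<eta> - F) x" "\<beta> = c \<eta> i" by blast
    have i_layer: "i \<in> layer \<Xi> N \<eta> - F"
      using i(1) by (rule subsetD[OF members_at_subset])
    then have "?rank i = \<eta>"
      using \<eta>(1) by (intro stage_rank_layer) auto
    then have "\<beta> = col i"
      using i(2) i_layer by (simp add: col_def)
    moreover have "layer \<Xi> N \<eta> - F \<subseteq> J"
      using N(1) unfolding layer_def by blast
    then have "i \<in> ?A"
      by (rule subsetD[OF members_at_mono i(1)])
    ultimately show ?thesis by blast
  next
    case False
    let ?A = "members_at D J x" and ?B = "piece D J x"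
    have A: "|{..<\<nu>}| <o |?A|"
      using False by (rule card_of_not_ordLeq)
    have "|?A| \<le>o |{..<\<mu>}|"
      by (rule card_of_subset_ordLeq[OF members_at_subset J_\<mu>])
    then have "\<beta> < \<mu>"
      using \<beta> ordLess_lessThan_imp_less ordLess_ordLeq_trans by blast
    then have "(?B, \<beta>) \<in> g ` {..<\<mu>}"
      unfolding g using piece_meets by blast
    then obtain \<tau> where \<tau>: "\<tau> < \<mu>" "g \<tau> = (?B, \<beta>)" by force
    \<comment> \<open>The indices used before step \<tau> number at most |\<nu>|, so their ranks are
      bounded by some \<xi>. The more than |\<nu>| members at x do not all fit into
      \<open>N \<xi>\<close>; one of them is still eligible, hence some trace from
      \<open>E \<tau>\<close> contains x.\<close>
    let ?U = "\<Union>\<sigma><\<tau>. E \<sigma>"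
    have "|?U| \<le>o |{..<\<nu>}|"
      by (rule card_of_UN_ordLeq[OF \<nu>(2) succ[OF \<tau>(1)] countable_ordLeq_infinite[OF E_countable \<nu>(2)]])
    then have "|?rank ` ?U| \<le>o |{..<\<nu>}|"
      by (rule ordLeq_transitive[OF card_of_image])
    moreover have "?rank ` ?U \<subseteq> {..<\<mu>}"
    proof (rule image_subsetI)
      fix j assume "j \<in> ?U"
      then have "j \<in> (\<Union>\<xi>\<in>\<Xi>. N \<xi>)" using E_J J_eq by blast
      then show "?rank j \<in> {..<\<mu>}" using stage_rank(1)[of j N \<Xi>] by (simp add: \<Xi>_def)
    qed
    ultimately obtain \<xi> where \<xi>: "\<xi> \<in> \<Xi>" "\<forall>\<alpha>\<in>?rank ` ?U. \<alpha> < \<xi>"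
      using bounded by blast
    have "\<not> ?A \<subseteq> N \<xi>"
      using card_of_subset_ordLeq[OF _ N_\<nu>[OF \<xi>(1)]] A not_ordLess_ordLeq by blast
    then obtain i where i: "i \<in> ?A" "i \<notin> N \<xi>" by blast
    have "i \<in> J"
      using i(1) by (rule subsetD[OF members_at_subset])
    then have "i \<in> N (?rank i)"
      using stage_rank(2)[of i N \<Xi>] J_eq by simp
    then have "\<xi> < ?rank i"
      using i(2) N(2)[of "?rank i" \<xi>] by (meson not_le subsetD)
    then have "i \<in> S ?U"
      using \<xi>(2) \<open>i \<in> J\<close> unfolding S_def by fastforce
    then obtain j where j: "j \<in> E \<tau>" "x \<in> open_trace D j ?B"
      using subcover(3)[OF _ members_at_open_trace[OF i(1)]] \<tau>(2) unfolding E[of \<tau>] by auto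
    then have "j \<in> ?A"
      using open_trace_members_at[OF j(2) mem_piece] E_J by blast
    moreover have "\<beta> = col j"
      using col_E[OF \<tau>(1) j(1)] \<tau>(2) by simp
    ultimately show ?thesis by blast
  qed
  then have "uncountably_good D J col"
    unfolding uncountably_good_def by blast
  then show ?thesis by blast
qed

text \<open>Induction on a bound \<mu>. If no smaller bound works, \<mu> is an initial ordinal of
  size |J|: a successor cardinal if some infinite \<nu> below it has the largest size there, a limit
  cardinal otherwise. The hypothesis makes the well-order of colors long enough.\<close>

lemma uncountably_good_exists:
  assumes "\<And>J :: 'k set. \<exists>\<mu> :: 'o::wellorder. |J| \<le>o |{..<\<mu>}|"
  shows "\<exists>c :: 'k \<Rightarrow> 'o. uncountably_good D J c"
proof -
  have "|J| \<le>o |{..<\<mu>}| \<Longrightarrow> \<exists>c :: 'k \<Rightarrow> 'o. uncountably_good D J c" for J and \<mu> :: 'o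
  proof (induction \<mu> arbitrary: J rule: less_induct)
    case (less \<mu>)
    show ?case
    proof (cases "countable J \<or> (\<exists>\<alpha><\<mu>. |J| \<le>o |{..<\<alpha>}| )")
      case True
      then show ?thesis using less.IH uncountably_good_countable by blast
    next
      case False
      then have J: "uncountable J" and min: "\<And>\<alpha>. \<alpha> < \<mu> \<Longrightarrow> |{..<\<alpha>}| <o |J|"
        by (auto intro: card_of_not_ordLeq)
      from J have "J \<noteq> {}" by auto
      then obtain h where h: "h ` {..<\<mu>} = J"
        using less.prems card_of_ordLeq2 by metis
      show ?thesis
      proof (cases "\<exists>\<nu><\<mu>. infinite {..<\<nu>} \<and> (\<forall>\<xi><\<mu>. |{..<\<xi>}| \<le>o |{..<\<nu>}| )")
        case True
        then obtain \<nu> where \<nu>: "\<nu> < \<mu>" "infinite {..<\<nu>}" "\<And>\<xi>. \<xi> < \<mu> \<Longrightarrow> |{..<\<xi>}| \<le>o |{..<\<nu>}|"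
          by blast
        show ?thesis
          by (rule successor_step[OF h J \<nu>(1,2) min[OF \<nu>(1)] \<nu>(3) less.IH])
      next
        case False
        have "\<exists>\<xi><\<mu>. |{..<\<nu>}| <o |{..<\<xi>}|" if "\<nu> < \<mu>" "infinite {..<\<nu>}" for \<nu>
          using False that card_of_not_ordLeq by blast
        then show ?thesis
          by (rule limit_step[OF h J _ less.IH])
      qed
    qed
  qed
  then show ?thesis using assms by blast
qed

end

section \<open>Ordinals over a type and the coding of covers with multiplicity\<close>

lemma ordinal_lessThan_card:
  fixes J :: "'k set"
  shows "\<exists>\<mu> :: 'k ordinal. |J| \<le>o |{..<\<mu>}|"
proof -
  let ?r = "|J|"
  have wo: "Well_order ?r" by (rule card_of_Well_order)
  \<comment> \<open>The order type of the strict predecessors of \<open>a\<close>; this maps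
    \<open>J\<close> injectively below the order type of |J|.\<close>
  define f where "f a = (abs_ordinal (Restr ?r (underS ?r a)) :: 'k ordinal)" for a
  have refl: "Restr ?r (underS ?r a) =o Restr ?r (underS ?r a)" for a
    using wo Well_order_Restr ordIso_reflexive by blast
  have ofilter: "wo_rel.ofilter ?r (underS ?r a)" for a
    using wo by (simp add: wo_rel.underS_ofilter wo_rel_def)
  have f_less: "f a < f b" if "underS ?r a \<subset> underS ?r b" for a b
  proof -
    have "Restr ?r (underS ?r a) <o Restr ?r (underS ?r b)"
      using ofilter_subset_ordLess[OF wo ofilter ofilter] that by blast
    then show ?thesis
      unfolding f_def using less_ordinal.abs_eq[OF refl refl] by blast
  qed
  have "inj_on f J"
  proof (rule inj_onI)
    fix a b assume ab: "a \<in> J" "b \<in> J" "f a = f b"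
    have "underS ?r a \<subseteq> underS ?r b \<or> underS ?r b \<subseteq> underS ?r a"
      using wo_rel.ofilter_linord[OF _ ofilter ofilter] wo by (simp add: wo_rel_def)
    then have eq: "underS ?r a = underS ?r b"
      using f_less[of a b] f_less[of b a] ab(3) by auto
    show "a = b"
    proof (rule ccontr)
      assume "a \<noteq> b"
      then have "(a, b) \<in> ?r \<or> (b, a) \<in> ?r"
        using ab(1,2) card_of_well_order_on[of J]
        unfolding well_order_on_def linear_order_on_def total_on_def by blast
      then show False
        using eq \<open>a \<noteq> b\<close> unfolding underS_def by blast
    qed
  qed
  moreover have "f ` J \<subseteq> {..<abs_ordinal ?r}"
  proof (rule image_subsetI)
    fix a assume "a \<in> J"
    then have "Restr ?r (underS ?r a) <o ?r"
      by (intro underS_Restr_ordLess[OF wo]) (auto simp: Field_card_of)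
    then show "f a \<in> {..<abs_ordinal ?r}"
      unfolding f_def using less_ordinal.abs_eq[OF refl ordIso_reflexive[OF wo]] by blast
  qed
  ultimately show ?thesis
    using card_of_ordLeq by blast
qed

theorem theorem7p4:
  fixes T :: "'x topology"
    and \<B> \<H> :: "'x set set"
    and m :: "'x set \<Rightarrow> 'i ordinal"
  assumes "hereditarily Lindelof_space T"
    and "\<B> \<subseteq> Pow (topspace T)"
    and "\<And>A B. A \<in> \<B> \<Longrightarrow> B \<in> \<B> \<Longrightarrow> A \<inter> B \<in> \<B>"
    and "well_founded_family \<B>"
    and "\<H> \<subseteq> countable_unions (family_meet \<B> T)"
    and "\<And>H. H \<in> \<H> \<Longrightarrow> m H \<noteq> 0"
  shows "\<exists>c. good_coloring_omega1 \<H> m c"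
proof -
  let ?HH = "with_mult \<H> m"
  have "\<exists>P. countable P \<and> P \<subseteq> \<B> \<times> {G. openin T G} \<and> H = (\<Union>(B, G)\<in>P. B \<inter> G)" if H: "H \<in> \<H>" for H
  proof -
    obtain \<X> where \<X>: "\<X> \<subseteq> family_meet \<B> T" "|\<X>| =o natLeq" "H = \<Union>\<X>"
      using H assms(5) unfolding countable_unions_def by blast
    have "\<forall>Y\<in>\<X>. \<exists>p. p \<in> \<B> \<times> {G. openin T G} \<and> Y = fst p \<inter> snd p"
      using \<X>(1) unfolding family_meet_def by fastforce
    then obtain p where p: "\<And>Y. Y \<in> \<X> \<Longrightarrow> p Y \<in> \<B> \<times> {G. openin T G} \<and> Y = fst (p Y) \<inter> snd (p Y)"
      by metis
    have "|\<X>| \<le>o |UNIV :: nat set|"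
      using \<X>(2) card_of_nat ordIso_imp_ordLeq ordIso_symmetric ordIso_transitive by blast
    then have "countable (p ` \<X>)"
      using countable_iff_ordLeq_nat countable_image by blast
    moreover have "p ` \<X> \<subseteq> \<B> \<times> {G. openin T G}"
      using p by blast
    moreover have "H = (\<Union>(B, G)\<in>p ` \<X>. B \<inter> G)"
      using p \<X>(3) by (auto simp: case_prod_unfold)
    ultimately show ?thesis by blast
  qed
  then obtain P where P: "\<And>H. H \<in> \<H> \<Longrightarrow>
      countable (P H) \<and> P H \<subseteq> \<B> \<times> {G. openin T G} \<and> H = (\<Union>(B, G)\<in>P H. B \<inter> G)"
    by metis
  \<comment> \<open>All copies of a set share its code. Other pairs get the empty code, since the
    locale imposes its conditions on every index.\<close>
  define D where "D p = (if fst p \<in> \<H> then P (fst p) else {})" for p :: "'x set \<times> 'i ordinal"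
  have D_sub: "D p \<subseteq> \<B> \<times> {G. openin T G}" for p
    using P by (simp add: D_def)
  have open_D: "openin T (open_trace D p B)" for p B
    unfolding open_trace_def using D_sub by (intro openin_Union) blast
  interpret coded_cover \<B> D
  proof
    fix B and S :: "('x set \<times> 'i ordinal) set"
    let ?U = "\<Union>p\<in>S. open_trace D p B"
    \<comment> \<open>The subspace is the union of the traces itself, which they cover by
      definition.\<close>
    have "Lindelof_space (subtopology T ?U)"
      using assms(1) by (simp add: hereditarily)
    moreover have "(\<forall>V \<in> (\<lambda>p. open_trace D p B) ` S. openin T V) \<and> topspace T \<inter> ?U \<subseteq> ?U"
      using open_D by blast
    ultimately have "\<exists>\<V>. countable \<V> \<and> \<V> \<subseteq> (\<lambda>p. open_trace D p B) ` S \<and> topspace T \<inter> ?U \<subseteq> \<Union>\<V>"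
      unfolding Lindelof_space_subtopology by (elim allE[of _ "(\<lambda>p. open_trace D p B) ` S"]) (erule mp)
    then obtain \<V> where \<V>: "countable \<V>" "\<V> \<subseteq> (\<lambda>p. open_trace D p B) ` S" "topspace T \<inter> ?U \<subseteq> \<Union>\<V>"
      by blast
    obtain C where C: "C \<subseteq> S" "countable C" "\<V> = (\<lambda>p. open_trace D p B) ` C"
      using countable_subset_image[of \<V> "\<lambda>p. open_trace D p B" S] \<V>(1,2) by blast
    have "?U \<subseteq> topspace T"
      using openin_subset[OF open_D] by blast
    then show "\<exists>C\<subseteq>S. countable C \<and> ?U \<subseteq> (\<Union>p\<in>C. open_trace D p B)"
      using \<V>(3) C by (intro exI[of _ C]) blast
    show "countable (D p)" for p
      using P by (simp add: D_def)
    show "B \<in> \<B>" if "(B, G) \<in> D p" for B G p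
      using that D_sub by blast
  qed (fact assms(4), fact assms(3))
  have at: "at_point ?HH x = members_at D ?HH x" for x
  proof -
    have "x \<in> H \<longleftrightarrow> (\<exists>(B, G)\<in>D (H, \<alpha>). x \<in> B \<and> x \<in> G)" if "H \<in> \<H>" for H \<alpha>
    proof -
      have "x \<in> H \<longleftrightarrow> x \<in> (\<Union>(B, G)\<in>P H. B \<inter> G)" using P[OF that] by metis
      then show ?thesis using that by (auto simp: D_def)
    qed
    then show ?thesis
      unfolding at_point_def members_at_def with_mult_def by auto
  qed
  obtain c :: "'x set \<times> 'i ordinal \<Rightarrow> ('x set \<times> 'i ordinal) ordinal"
    where c: "uncountably_good D ?HH c"
    using uncountably_good_exists[OF ordinal_lessThan_card] by blast
  have "good_coloring_omega1 \<H> m (\<lambda>p. if p \<in> ?HH then Some (c p) else None)"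
    unfolding good_coloring_omega1_def
  proof (intro conjI allI impI ballI subsetI)
    fix \<kappa> :: "('x set \<times> 'i ordinal) ordinal" and x \<beta>
    assume \<kappa>: "cardinal_ordinal \<kappa> \<and> cardSuc natLeq \<le>o |{..<\<kappa>}|"
      and x: "|{..<\<kappa>}| \<le>o |at_point ?HH x|" and \<beta>: "\<beta> \<in> {..<\<kappa>}"
    have "natLeq <o |at_point ?HH x|"
      by (rule ordLess_ordLeq_trans[OF cardSuc_greater[OF natLeq_Card_order]
            ordLeq_transitive[OF conjunct2[OF \<kappa>] x]])
    then have "\<not> |at_point ?HH x| \<le>o |UNIV :: nat set|"
      using card_of_nat ordLeq_ordIso_trans not_ordLess_ordLeq by blast
    then have unc: "uncountable (members_at D ?HH x)"
      unfolding at[symmetric] countable_iff_ordLeq_nat .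
    have "|{..<\<beta>}| \<le>o |{..<\<kappa>}|"
      using \<beta> by (intro card_of_lessThan_mono) auto
    \<comment> \<open>The initial ordinal \<kappa> exceeds in size every ordinal below it, so
      \<beta> < \<kappa> becomes the strict comparison that \<open>uncountably_good\<close> asks
      for.\<close>
    moreover have "\<not> |{..<\<beta>}| =o |{..<\<kappa>}|"
      using \<kappa> \<beta> unfolding cardinal_ordinal_def by blast
    ultimately have "|{..<\<beta>}| <o |{..<\<kappa>}|"
      using ordLeq_iff_ordLess_or_ordIso by blast
    then have "|{..<\<beta>}| <o |members_at D ?HH x|"
      using x unfolding at by (rule ordLess_ordLeq_trans)
    then have "\<beta> \<in> c ` members_at D ?HH x"
      by (rule uncountably_goodD[OF c unc])
    then show "\<beta> \<in> {\<beta>. \<exists>p\<in>at_point ?HH x. (if p \<in> ?HH then Some (c p) else None) = Some \<beta>}"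
      unfolding at using members_at_subset by fastforce
  qed (auto split: if_splits)
  then show ?thesis by blast
qed

end
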